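(* Let $Z$ be a real $n\times r$ matrix with columns $z_1,\dots,z_r\in\mathbf{R}^n$ such that the zonotope $P(Z)=\{Zy: y\in\mathbf{R}^r,\ -1\le y_i\le 1,\ 1\le i\le r\}$ is an $n$-dimensional parallelotope. Let $\beta_1,\dots,\beta_r>0$ be scalars such that the system of vectors $\{\beta_iz_i:1\le i\le r\}$ is unimodular, and let $Z_\beta$ be the $n\times r$ matrix whose columns are $\sqrt{2\beta_i}\,z_i$, $1\le i\le r$. If $A$ is a real $n\times n$ matrix satisfying $$A^TA=(Z_\beta Z_\beta^T)^{-1},$$ then the map $x\mapsto Ax$ transforms $P(Z)$ into a Voronoi polytope.
   Context: A parallelotope is a convex polytope whose translates fill the space $\mathbf{R}^n$ facet to facet without overlapping interiors. The Voronoi polytope of a lattice $L\subset\mathbf{R}^n$ related to a point $t_0\in L$ is the set of points of $\mathbf{R}^n$ that are at least as near to $t_0$ as to any other point of $L$, in the usual Euclidean norm; "a Voronoi polytope" means the Voronoi polytope of some full-rank lattice in $\mathbf{R}^n$ related to one of its points. A set $X$ of vectors spanning $\mathbf{R}^n$ is called unimodular if for every subset $B\subseteq X$ of $n$ linearly independent vectors, every vector of $X$ is an integer linear combination of the vectors of $B$. (When $P(Z)$ is a parallelotope, the matroid represented by the columns of $Z$ is regular, and scalars $\beta_i>0$ as in the claim exist.) *)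

theory Defs
  imports "HOL-Analysis.Analysis"
begin

text \<open>
  A tile is full-dimensional: without the condition on the affine dimension, disjointness of
  interiors would be vacuous. The set \<open>T\<close> of translation vectors is not required to be a lattice.
  Facet to facet: every facet of a tile is also a facet of another tile.
\<close>

definition parallelotope :: "'a::euclidean_space set \<Rightarrow> bool" where
  "parallelotope P \<longleftrightarrow>
     polytope P \<and> aff_dim P = int DIM('a) \<and>
     (\<exists>T. (\<Union>t\<in>T. (+) t ` P) = UNIV \<and>
          (\<forall>s\<in>T. \<forall>t\<in>T. s \<noteq> t \<longrightarrow> interior ((+) s ` P) \<inter> interior ((+) t ` P) = {}) \<and>
          (\<forall>t\<in>T. \<forall>F. F facet_of ((+) t ` P) \<longrightarrow> (\<exists>s\<in>T. s \<noteq> t \<and> F facet_of ((+) s ` P))))"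

definition full_rank_lattice :: "'a::euclidean_space set \<Rightarrow> bool" where
  "full_rank_lattice L \<longleftrightarrow>
     (\<exists>B. independent B \<and> span B = UNIV \<and>
          L = {\<Sum>b\<in>B. of_int (c b) *\<^sub>R b | c :: 'a \<Rightarrow> int. True})"

definition voronoi_cell :: "'a::euclidean_space set \<Rightarrow> 'a \<Rightarrow> 'a set" where
  "voronoi_cell L t0 = {x. \<forall>t\<in>L. dist x t0 \<le> dist x t}"

definition voronoi_polytope :: "'a::euclidean_space set \<Rightarrow> bool" where
  "voronoi_polytope P \<longleftrightarrow> (\<exists>L t0. full_rank_lattice L \<and> t0 \<in> L \<and> P = voronoi_cell L t0)"

definition unimodular :: "'a::euclidean_space set \<Rightarrow> bool" where
  "unimodular X \<longleftrightarrow>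
     span X = UNIV \<and>
     (\<forall>B. B \<subseteq> X \<and> independent B \<and> card B = DIM('a) \<longrightarrow>
        (\<forall>x\<in>X. \<exists>c :: 'a \<Rightarrow> int. x = (\<Sum>b\<in>B. of_int (c b) *\<^sub>R b)))"

definition zonotope :: "real ^ 'r ^ 'n \<Rightarrow> (real ^ 'n) set" where
  "zonotope Z = {Z *v y | y. \<forall>i. - 1 \<le> y $ i \<and> y $ i \<le> 1}"

definition scaled_matrix :: "real ^ 'r ^ 'n \<Rightarrow> ('r \<Rightarrow> real) \<Rightarrow> real ^ 'r ^ 'n" where
  "scaled_matrix Z \<beta> = (\<chi> i j. sqrt (2 * \<beta> j) * Z $ i $ j)"

end

theory Submission
  imports Defs
begin

text \<open>
  Write \<open>z\<^sub>i\<close> for the columns of \<open>Z\<close>, put \<open>w\<^sub>i = \<beta>\<^sub>i z\<^sub>i\<close>, and let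
  \<open>Q = Z\<^sub>\<beta> Z\<^sub>\<beta>\<^sup>T\<close>, so that \<open>Qu \<bullet> u = 2 \<Sum>\<^sub>i \<beta>\<^sub>i (z\<^sub>i \<bullet> u)\<^sup>2\<close>. Let \<open>D\<close> be the set of all \<open>u\<close> whose
  inner products with all \<open>w\<^sub>i\<close> are integers. Unimodularity makes \<open>D\<close> the dual of the lattice
  generated by any basis chosen among the \<open>w\<^sub>i\<close>, hence a lattice of full rank. The image of the
  zonotope turns out to be the Voronoi cell of the lattice \<open>L = AQD\<close> at the origin.

  Indeed \<open>A\<^sup>T A Q = 1\<close> gives \<open>Ax \<bullet> AQu = x \<bullet> u\<close> and \<open>AQu \<bullet> AQu = Qu \<bullet> u\<close>, so \<open>Ax\<close> is at least as
  near to the origin as to \<open>AQu\<close> iff \<open>x \<bullet> u \<le> \<Sum>\<^sub>i \<beta>\<^sub>i (z\<^sub>i \<bullet> u)\<^sup>2\<close>. On the other hand \<open>x\<close> lies in the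
  zonotope iff \<open>x \<bullet> u \<le> \<Sum>\<^sub>i \<bar>z\<^sub>i \<bullet> u\<bar>\<close> for every real vector \<open>u\<close>, the right-hand side being the support
  function of the zonotope (\<open>mem_zonotope_iff\<close>). The \<open>i\<close>-th terms of the two sums are
  \<open>(w\<^sub>i \<bullet> u)\<^sup>2 / \<beta>\<^sub>i\<close> and \<open>\<bar>w\<^sub>i \<bullet> u\<bar> / \<beta>\<^sub>i\<close>. For \<open>u\<close> in \<open>D\<close> the second is at most the first, because
  \<open>\<bar>k\<bar> \<le> k\<^sup>2\<close> for integers \<open>k\<close>; this puts the image of the zonotope inside the Voronoi cell.

  For the converse inclusion, call \<open>u\<close> a sign vector if every \<open>w\<^sub>i \<bullet> u\<close> is \<open>-1\<close>, \<open>0\<close> or \<open>1\<close>. Sign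
  vectors lie in \<open>D\<close>, and on them the two sums agree. The crucial fact is that every real vector
  \<open>u\<close> is a sum of nonnegative multiples of sign vectors without cancellation, which means that each
  \<open>\<bar>w\<^sub>i \<bullet> u\<bar>\<close> is the sum of the corresponding absolute values; so the inequalities for sign vectors
  add up to the inequality for \<open>u\<close> (\<open>mem_zonotope_iff_dual_lattice\<close>). This fact is stated as the
  induction principle \<open>unimodular_conformal_induct\<close>. It combines two observations: the
  vectors \<open>u\<close> whose set of nonzero products \<open>w\<^sub>i \<bullet> u\<close> is minimal are multiples of sign vectors
  (\<open>unimodular_elementary_sign_vector\<close>), and below every nonzero vector there is such a vector with
  matching signs that can be subtracted until one more product vanishes.
\<close>

section \<open>Elementary vectors of a unimodular system\<close>

definition inner_support :: "'a::euclidean_space set \<Rightarrow> 'a \<Rightarrow> 'a set" where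
  "inner_support X v = {x \<in> X. x \<bullet> v \<noteq> 0}"

text \<open>
  When the spanning set consists of the columns of a matrix, the vectors \<open>(x \<bullet> v)\<^sub>x\<close> form its row
  space; elementary vectors are the nonzero ones of minimal support there, corresponding to
  cocircuits of the matroid, or geometrically to normals of the facets of the zonotope.
\<close>

definition elementary :: "'a::euclidean_space set \<Rightarrow> 'a \<Rightarrow> bool" where
  "elementary X v \<longleftrightarrow> v \<noteq> 0 \<and> (\<forall>v'. v' \<noteq> 0 \<longrightarrow> \<not> inner_support X v' \<subset> inner_support X v)"

lemma inner_support_nonempty:
  assumes "span X = UNIV" "v \<noteq> 0"
  obtains x where "x \<in> X" "x \<bullet> v \<noteq> 0"
proof -
  have "\<exists>x\<in>X. x \<bullet> v \<noteq> 0"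
  proof (rule ccontr)
    assume "\<not> (\<exists>x\<in>X. x \<bullet> v \<noteq> 0)"
    then have "\<And>x. x \<in> X \<Longrightarrow> orthogonal v x"
      by (auto simp: orthogonal_def inner_commute)
    then have "orthogonal v v"
      using orthogonal_to_span[of v X v] assms(1) by auto
    then show False using assms(2) by (simp add: orthogonal_def)
  qed
  then show thesis using that by blast
qed

text \<open>
  If the zeros of \<open>v\<close> spanned less than the hyperplane orthogonal to \<open>v\<close>, there would be room for a
  second vector with the same zeros, and a combination of the two would have a further zero.
\<close>

lemma elementary_zeros_span_hyperplane:
  assumes "span X = UNIV" "elementary X v"
  shows "span {x \<in> X. x \<bullet> v = 0} = {y. v \<bullet> y = 0}"
proof
  let ?H = "{x \<in> X. x \<bullet> v = 0}"
  show "span ?H \<subseteq> {y. v \<bullet> y = 0}"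
    by (rule span_minimal) (auto simp: inner_commute[of v] subspace_hyperplane[of v, unfolded inner_commute[of v]])
  show "{y. v \<bullet> y = 0} \<subseteq> span ?H"
  proof (rule ccontr)
    assume "\<not> {y. v \<bullet> y = 0} \<subseteq> span ?H"
    then obtain y where y: "v \<bullet> y = 0" "y \<notin> span ?H" by blast
    obtain p q where pq: "p \<in> span ?H" "\<And>w. w \<in> span ?H \<Longrightarrow> orthogonal q w" "y = p + q"
      using orthogonal_subspace_decomp_exists[of ?H y] by blast
    have q0: "q \<noteq> 0" using pq(1,3) y(2) by auto
    have vq: "v \<bullet> q = 0"
    proof -
      have "p \<in> {y. v \<bullet> y = 0}"
        using pq(1) \<open>span ?H \<subseteq> {y. v \<bullet> y = 0}\<close> by blast
      then show ?thesis using y(1) pq(3) by (simp add: inner_add_right)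
    qed
    obtain x where x: "x \<in> X" "x \<bullet> v \<noteq> 0"
      using inner_support_nonempty[OF assms(1)] assms(2) by (auto simp: elementary_def)
    \<comment> \<open>The combination of \<open>q\<close> and \<open>v\<close> that vanishes on \<open>x\<close>, a vector on which \<open>v\<close> does not vanish.\<close>
    define v' where "v' = (x \<bullet> v) *\<^sub>R q - (x \<bullet> q) *\<^sub>R v"
    have "v' \<bullet> q = (x \<bullet> v) * (q \<bullet> q)"
      using vq by (simp add: v'_def inner_diff_left)
    then have "v' \<noteq> 0" using x(2) q0 by auto
    have "z \<bullet> v' = 0" if "z \<in> X" "z \<bullet> v = 0" for z
    proof -
      have "z \<in> span ?H" using that by (auto intro: span_base)
      then have "z \<bullet> q = 0" using pq(2)[of z] by (simp add: orthogonal_def inner_commute[of z])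
      then show ?thesis using that by (simp add: v'_def inner_diff_right)
    qed
    then have "inner_support X v' \<subseteq> inner_support X v"
      by (auto simp: inner_support_def)
    moreover have "x \<notin> inner_support X v'"
      by (simp add: inner_support_def v'_def inner_diff_right)
    ultimately have "inner_support X v' \<subset> inner_support X v"
      using x by (auto simp: inner_support_def)
    then show False using assms(2) \<open>v' \<noteq> 0\<close> by (auto simp: elementary_def)
  qed
qed

text \<open>
  The zeros of \<open>v\<close> contain a basis of the hyperplane orthogonal to \<open>v\<close>, and adding \<open>z\<close> completes it
  to a basis of the whole space. In the integer expansion of \<open>x\<close> in this basis only the term of \<open>z\<close>
  contributes to the inner product with \<open>v\<close>.
\<close>

lemma unimodular_elementary_divides:
  assumes U: "unimodular X" and E: "elementary X v"
    and x: "x \<in> X" and z: "z \<in> X" "z \<bullet> v \<noteq> 0"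
  obtains k :: int where "x \<bullet> v = of_int k * (z \<bullet> v)"
proof -
  let ?H = "{x \<in> X. x \<bullet> v = 0}"
  have sp: "span X = UNIV" using U by (simp add: unimodular_def)
  have H: "span ?H = {y. v \<bullet> y = 0}"
    by (rule elementary_zeros_span_hyperplane[OF sp E])
  obtain B where B: "B \<subseteq> ?H" "independent B" "?H \<subseteq> span B"
    using maximal_independent_subset[of ?H] by blast
  have sB: "span B = span ?H"
    using B(1,3) by (metis span_mono span_span subset_antisym)
  have zB: "z \<notin> span B" using sB H z(2) by (auto simp: inner_commute)
  have v0: "v \<noteq> 0" using E by (simp add: elementary_def)
  have indep: "independent (insert z B)" using B(2) zB by (simp add: independent_insert)
  have finB: "finite B" using B(2) by (rule independent_imp_finite)
  have "card B = DIM('a) - 1"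
    using dim_eq_card[OF sB B(2)] H dim_hyperplane[OF v0] by (metis dim_span)
  moreover have "z \<notin> B" using zB span_base by blast
  ultimately have card: "card (insert z B) = DIM('a)"
    using finB DIM_positive[where 'a='a] by (simp add: Suc_diff_1)
  obtain c :: "'a \<Rightarrow> int" where c: "x = (\<Sum>b\<in>insert z B. of_int (c b) *\<^sub>R b)"
  proof -
    have "insert z B \<subseteq> X" using B(1) z(1) by blast
    then have "\<exists>c :: 'a \<Rightarrow> int. x = (\<Sum>b\<in>insert z B. of_int (c b) *\<^sub>R b)"
      using U indep card x unfolding unimodular_def by blast
    then show thesis using that by blast
  qed
  have "x \<bullet> v = (\<Sum>b\<in>insert z B. of_int (c b) * (b \<bullet> v))"
    by (subst c) (simp add: inner_sum_left)
  also have "\<dots> = of_int (c z) * (z \<bullet> v) + (\<Sum>b\<in>B. of_int (c b) * (b \<bullet> v))"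
    using finB \<open>z \<notin> B\<close> by simp
  also have "(\<Sum>b\<in>B. of_int (c b) * (b \<bullet> v)) = 0"
    using B(1) by (intro sum.neutral) auto
  finally show thesis using that[of "c z"] by simp
qed

text \<open>
  By the previous lemma any two nonzero products are integer multiples of each other, so they have
  the same absolute value.
\<close>

lemma unimodular_elementary_sign_vector:
  assumes U: "unimodular X" and E: "elementary X v"
  obtains s where "s > 0" "\<And>x. x \<in> X \<Longrightarrow> x \<bullet> v \<in> {- s, 0, s}"
proof -
  have sp: "span X = UNIV" using U by (simp add: unimodular_def)
  obtain z where z: "z \<in> X" "z \<bullet> v \<noteq> 0"
    using inner_support_nonempty[OF sp] E by (auto simp: elementary_def)
  have abs_le: "\<bar>y \<bullet> v\<bar> \<le> \<bar>x \<bullet> v\<bar>" if xy: "x \<in> X" "y \<in> X" "y \<bullet> v \<noteq> 0" "x \<bullet> v \<noteq> 0" for x y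
  proof -
    obtain k :: int where k: "x \<bullet> v = of_int k * (y \<bullet> v)"
      using unimodular_elementary_divides[OF U E xy(1,2,3)] .
    then have "k \<noteq> 0" using xy(4) by auto
    then have "1 \<le> \<bar>of_int k :: real\<bar>" by linarith
    then have "1 * \<bar>y \<bullet> v\<bar> \<le> \<bar>of_int k\<bar> * \<bar>y \<bullet> v\<bar>" by (rule mult_right_mono) simp
    then show ?thesis using k by (simp add: abs_mult)
  qed
  have "x \<bullet> v \<in> {- \<bar>z \<bullet> v\<bar>, 0, \<bar>z \<bullet> v\<bar>}" if "x \<in> X" for x
  proof (cases "x \<bullet> v = 0")
    case False
    then have "\<bar>x \<bullet> v\<bar> = \<bar>z \<bullet> v\<bar>"
      using abs_le[OF that z False] abs_le[OF z(1) that False z(2)] by linarith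
    then show ?thesis by (auto simp: abs_if split: if_splits)
  qed simp
  then show thesis using that[of "\<bar>z \<bullet> v\<bar>"] z(2) by auto
qed

section \<open>Conformal decomposition\<close>

text \<open>
  The condition on the support is separate because a nonnegative product still allows
  \<open>x \<bullet> u = 0\<close> and \<open>x \<bullet> v \<noteq> 0\<close>.
\<close>

definition conformal :: "'a::euclidean_space set \<Rightarrow> 'a \<Rightarrow> 'a \<Rightarrow> bool" where
  "conformal X v u \<longleftrightarrow> inner_support X v \<subseteq> inner_support X u \<and> (\<forall>x\<in>X. 0 \<le> (x \<bullet> v) * (x \<bullet> u))"

lemma conformal_trans:
  assumes "conformal X a b" "conformal X b c"
  shows "conformal X a c"
proof -
  have "0 \<le> (x \<bullet> a) * (x \<bullet> c)" if x: "x \<in> X" for x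
  proof (cases "x \<bullet> b = 0")
    case True
    then have "x \<bullet> a = 0" using assms(1) x by (auto simp: conformal_def inner_support_def)
    then show ?thesis by simp
  next
    case False
    then show ?thesis
      using assms x unfolding conformal_def
      by (smt (verit, best) mult_neg_neg mult_nonneg_nonneg zero_le_mult_iff)
  qed
  then show ?thesis using assms by (auto simp: conformal_def)
qed

text \<open>
  Subtracting a multiple of \<open>v\<close> from \<open>u\<close> kills a product with \<open>u\<close> and reverses no sign if the
  multiplier has the smallest possible absolute value. The multiplier is negative when \<open>u\<close> and \<open>v\<close>
  have opposite signs at \<open>x\<close>.
\<close>

lemma shrink_support:
  assumes "finite X" "span X = UNIV" "v \<noteq> 0" and sub: "inner_support X v \<subseteq> inner_support X u"
  obtains x t where "x \<in> X" "x \<bullet> v \<noteq> 0" "t = (x \<bullet> u) / (x \<bullet> v)"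
    "\<And>y. y \<in> X \<Longrightarrow> \<bar>t * (y \<bullet> v)\<bar> \<le> \<bar>y \<bullet> u\<bar>" "inner_support X (u - t *\<^sub>R v) \<subset> inner_support X u"
proof -
  let ?r = "\<lambda>y. \<bar>y \<bullet> u\<bar> / \<bar>y \<bullet> v\<bar>"
  have fin: "finite (inner_support X v)" using assms(1) by (simp add: inner_support_def)
  have ne: "inner_support X v \<noteq> {}"
    using inner_support_nonempty[OF assms(2,3)] by (auto simp: inner_support_def)
  obtain x where x: "x \<in> inner_support X v" "\<forall>y\<in>inner_support X v. ?r x \<le> ?r y"
    using obtains_Min[of "?r ` inner_support X v"] fin ne
    by (metis (mono_tags, lifting) arg_min_if_finite(1) arg_min_least)
  define t where "t = (x \<bullet> u) / (x \<bullet> v)"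
  have xX: "x \<in> X" "x \<bullet> v \<noteq> 0" using x(1) by (auto simp: inner_support_def)
  have bound: "\<bar>t * (y \<bullet> v)\<bar> \<le> \<bar>y \<bullet> u\<bar>" if "y \<in> X" for y
  proof (cases "y \<bullet> v = 0")
    case False
    then have "?r x \<le> ?r y" using x(2) that by (auto simp: inner_support_def)
    then have "?r x * \<bar>y \<bullet> v\<bar> \<le> \<bar>y \<bullet> u\<bar>" using False by (simp add: pos_le_divide_eq)
    then show ?thesis by (simp add: t_def abs_mult abs_divide)
  qed simp
  have "inner_support X (u - t *\<^sub>R v) \<subseteq> inner_support X u"
    using sub by (auto simp: inner_support_def inner_diff_right)
  moreover have "x \<bullet> (u - t *\<^sub>R v) = 0" using xX by (simp add: t_def inner_diff_right)
  ultimately have "inner_support X (u - t *\<^sub>R v) \<subset> inner_support X u"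
    using x(1) sub by (auto simp: inner_support_def)
  then show thesis using that[OF xX t_def] bound by blast
qed

text \<open>
  Descent on the size of the support: if some \<open>v\<close> has smaller support than \<open>u\<close>, a multiple of it
  can be subtracted from \<open>u\<close>. What remains is conformal to \<open>u\<close> and has smaller support, but is nonzero
  since \<open>u\<close> is not a multiple of \<open>v\<close>.
\<close>

lemma conformal_elementary_exists:
  assumes "finite X" "span X = UNIV" "u \<noteq> 0"
  obtains v where "elementary X v" "conformal X v u"
proof -
  have "u \<noteq> 0 \<Longrightarrow> \<exists>v. elementary X v \<and> conformal X v u"
  proof (induction "card (inner_support X u)" arbitrary: u rule: less_induct)
    case less
    show ?case
    proof (cases "elementary X u")
      case True
      then show ?thesis by (auto simp: conformal_def)
    next
      case False
      then obtain v where v: "v \<noteq> 0" "inner_support X v \<subset> inner_support X u"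
        using less.prems by (auto simp: elementary_def)
      obtain x t where t: "\<And>y. y \<in> X \<Longrightarrow> \<bar>t * (y \<bullet> v)\<bar> \<le> \<bar>y \<bullet> u\<bar>"
        and smaller: "inner_support X (u - t *\<^sub>R v) \<subset> inner_support X u"
        using shrink_support[OF assms(1,2) v(1)] v(2) by (metis psubset_imp_subset)
      have "u - t *\<^sub>R v \<noteq> 0"
      proof
        assume "u - t *\<^sub>R v = 0"
        then have "u = t *\<^sub>R v" by simp
        then have "inner_support X u \<subseteq> inner_support X v"
          by (auto simp: inner_support_def)
        then show False using v(2) by blast
      qed
      moreover have "card (inner_support X (u - t *\<^sub>R v)) < card (inner_support X u)"
        using smaller assms(1) by (intro psubset_card_mono) (auto simp: inner_support_def)
      ultimately obtain e where e: "elementary X e" "conformal X e (u - t *\<^sub>R v)"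
        using less.hyps by blast
      have "0 \<le> (y \<bullet> (u - t *\<^sub>R v)) * (y \<bullet> u)" if "y \<in> X" for y
        using t[OF that] by (simp add: inner_diff_right zero_le_mult_iff) linarith
      then have "conformal X (u - t *\<^sub>R v) u"
        using smaller by (auto simp: conformal_def)
      then show ?thesis using e conformal_trans by blast
    qed
  qed
  then show thesis using assms(3) that by blast
qed

text \<open>
  Every vector is a sum of positive multiples of sign vectors without cancellation in any product
  with \<open>X\<close>. Such a multiple, conformal to \<open>u\<close>, is split off as far as the signs permit; the rest has
  smaller support.
\<close>

theorem unimodular_conformal_induct:
  assumes U: "unimodular X" and fin: "finite X"
    and zero: "P 0"
    and sign: "\<And>v s. s > 0 \<Longrightarrow> (\<And>x. x \<in> X \<Longrightarrow> x \<bullet> v \<in> {- 1, 0, 1}) \<Longrightarrow> P (s *\<^sub>R v)"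
    and add: "\<And>v w. P v \<Longrightarrow> P w \<Longrightarrow>
      (\<And>x. x \<in> X \<Longrightarrow> \<bar>x \<bullet> (v + w)\<bar> = \<bar>x \<bullet> v\<bar> + \<bar>x \<bullet> w\<bar>) \<Longrightarrow> P (v + w)"
  shows "P u"
proof (induction "card (inner_support X u)" arbitrary: u rule: less_induct)
  case less
  have sp: "span X = UNIV" using U by (simp add: unimodular_def)
  show ?case
  proof (cases "u = 0")
    case False
    then obtain v where v: "elementary X v" "conformal X v u"
      using conformal_elementary_exists[OF fin sp] by blast
    have v0: "v \<noteq> 0" using v(1) by (simp add: elementary_def)
    obtain s where s: "s > 0" "\<And>x. x \<in> X \<Longrightarrow> x \<bullet> v \<in> {- s, 0, s}"
      using unimodular_elementary_sign_vector[OF U v(1)] by blast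
    obtain x t where x: "x \<in> X" "x \<bullet> v \<noteq> 0" "t = (x \<bullet> u) / (x \<bullet> v)"
      and t: "\<And>y. y \<in> X \<Longrightarrow> \<bar>t * (y \<bullet> v)\<bar> \<le> \<bar>y \<bullet> u\<bar>"
      and smaller: "inner_support X (u - t *\<^sub>R v) \<subset> inner_support X u"
      using shrink_support[OF fin sp v0] v(2) unfolding conformal_def by metis
    have "x \<bullet> u \<noteq> 0" "0 \<le> (x \<bullet> v) * (x \<bullet> u)"
      using x(1,2) v(2) by (auto simp: conformal_def inner_support_def)
    then have tpos: "t > 0" using x(2,3) by (simp add: zero_le_mult_iff zero_less_divide_iff) linarith
    have "P ((t * s) *\<^sub>R ((1 / s) *\<^sub>R v))"
      using s tpos by (intro sign) (force simp: field_simps)+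
    then have "P (t *\<^sub>R v)" using s(1) by simp
    moreover have "P (u - t *\<^sub>R v)"
    proof (rule less.hyps)
      show "card (inner_support X (u - t *\<^sub>R v)) < card (inner_support X u)"
        using smaller fin by (intro psubset_card_mono) (auto simp: inner_support_def)
    qed
    moreover have "\<bar>y \<bullet> (t *\<^sub>R v + (u - t *\<^sub>R v))\<bar> = \<bar>y \<bullet> (t *\<^sub>R v)\<bar> + \<bar>y \<bullet> (u - t *\<^sub>R v)\<bar>"
      if "y \<in> X" for y
    proof -
      have "0 \<le> (y \<bullet> v) * (y \<bullet> u)" using v(2) that by (auto simp: conformal_def)
      then have "0 \<le> (t * (y \<bullet> v)) * (y \<bullet> u)"
        using tpos by (simp add: mult.assoc)
      moreover have "\<bar>a\<bar> + \<bar>b - a\<bar> = \<bar>b\<bar>" if "0 \<le> a * b" "\<bar>a\<bar> \<le> \<bar>b\<bar>" for a b :: real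
        using that by (auto simp: zero_le_mult_iff)
      ultimately show ?thesis
        using t[OF that] by (simp add: inner_diff_right)
    qed
    ultimately have "P (t *\<^sub>R v + (u - t *\<^sub>R v))" by (rule add)
    then show ?thesis by simp
  qed (use zero in simp)
qed

section \<open>Lattices\<close>

lemma full_rank_lattice_linear_image:
  fixes f :: "'a::euclidean_space \<Rightarrow> 'a"
  assumes L: "full_rank_lattice L" and f: "linear f" "inj f"
  shows "full_rank_lattice (f ` L)"
proof -
  obtain B where B: "independent B" "span B = UNIV"
    "L = {\<Sum>b\<in>B. of_int (c b) *\<^sub>R b | c :: 'a \<Rightarrow> int. True}"
    using L by (auto simp: full_rank_lattice_def)
  have inj: "inj_on f S" for S using f(2) by (rule inj_on_subset) simp
  have comb: "f (\<Sum>b\<in>B. of_int (c b) *\<^sub>R b) = (\<Sum>b\<in>f ` B. of_int (c (inv f b)) *\<^sub>R b)"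
    for c :: "'a \<Rightarrow> int"
    by (simp add: linear_sum[OF f(1)] linear_scale[OF f(1)] sum.reindex[OF inj] f(2))
  have "independent (f ` B)"
    using B(1) f inj by (simp add: linear_independent_injective_image)
  moreover have "span (f ` B) = UNIV"
    using linear_span_image[OF f(1)] B(2) linear_injective_imp_surjective[OF f] by metis
  moreover have "f ` L = {\<Sum>b\<in>f ` B. of_int (c b) *\<^sub>R b | c :: 'a \<Rightarrow> int. True}"
  proof (intro subset_antisym subsetI)
    fix y assume "y \<in> f ` L"
    then obtain c :: "'a \<Rightarrow> int" where "y = f (\<Sum>b\<in>B. of_int (c b) *\<^sub>R b)"
      using B(3) by auto
    then have "y = (\<Sum>b\<in>f ` B. of_int ((c \<circ> inv f) b) *\<^sub>R b)"
      by (simp add: comb)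
    then show "y \<in> {\<Sum>b\<in>f ` B. of_int (c b) *\<^sub>R b | c :: 'a \<Rightarrow> int. True}" by blast
  next
    fix y assume "y \<in> {\<Sum>b\<in>f ` B. of_int (c b) *\<^sub>R b | c :: 'a \<Rightarrow> int. True}"
    then obtain c :: "'a \<Rightarrow> int" where "y = (\<Sum>b\<in>f ` B. of_int (c b) *\<^sub>R b)" by auto
    then have "y = f (\<Sum>b\<in>B. of_int ((c \<circ> f) b) *\<^sub>R b)"
      by (simp add: linear_sum[OF f(1)] linear_scale[OF f(1)] sum.reindex[OF inj])
    then show "y \<in> f ` L" using B(3) by blast
  qed
  ultimately show ?thesis unfolding full_rank_lattice_def by blast
qed

text \<open>
  For a basis \<open>B\<close> chosen from \<open>X\<close>, integrality on \<open>B\<close> implies integrality on \<open>X\<close>. The linear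
  bijection \<open>g u = \<Sum>\<^bsub>b\<in>B\<^esub> (b \<bullet> u) b\<close> records the products with \<open>B\<close> as coordinates and so identifies the
  set in question with the lattice generated by \<open>B\<close>; this replaces an explicit dual basis.
\<close>

lemma dual_lattice_of_unimodular:
  fixes X :: "'a::euclidean_space set"
  assumes U: "unimodular X"
  shows "full_rank_lattice {u. \<forall>x\<in>X. x \<bullet> u \<in> \<int>}"
proof -
  have sp: "span X = UNIV" using U by (simp add: unimodular_def)
  obtain B where B: "B \<subseteq> X" "independent B" "X \<subseteq> span B"
    using maximal_independent_subset[of X] by blast
  have sB: "span B = UNIV" using B(3) sp by (metis span_mono span_span top.extremum_uniqueI)
  have fin: "finite B" using B(2) by (rule independent_imp_finite)
  have card: "card B = DIM('a)"
    using dim_eq_card[of B UNIV] B(2) sB by simp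
  define g where "g u = (\<Sum>b\<in>B. (b \<bullet> u) *\<^sub>R b)" for u
  have lin: "linear g"
    by (auto simp: g_def inner_add_right scaleR_add_left sum.distrib scaleR_sum_right intro!: linearI)
  have coords: "\<forall>b\<in>B. b \<bullet> u = k b" if "g u = (\<Sum>b\<in>B. k b *\<^sub>R b)" for u k
  proof -
    have "(\<Sum>b\<in>B. (b \<bullet> u - k b) *\<^sub>R b) = 0"
      using that by (simp add: g_def scaleR_diff_left sum_subtractf)
    then show ?thesis using B(2) fin independentD[OF B(2) fin subset_refl] by fastforce
  qed
  have injg: "inj g"
  proof (subst linear_injective_0[OF lin], intro allI impI)
    fix u assume "g u = 0"
    then have "\<forall>b\<in>B. b \<bullet> u = 0" using coords[of u "\<lambda>_. 0"] by simp
    then show "u = 0" using inner_support_nonempty[OF sB] by metis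
  qed
  let ?D = "{u. \<forall>x\<in>X. x \<bullet> u \<in> \<int>}"
  define M where "M = {\<Sum>b\<in>B. of_int (c b) *\<^sub>R b | c :: 'a \<Rightarrow> int. True}"
  have "full_rank_lattice M" using B(2) sB M_def by (auto simp: full_rank_lattice_def)
  moreover have "surj g" using linear_injective_imp_surjective[OF lin injg] by simp
  moreover have iff: "u \<in> ?D \<longleftrightarrow> g u \<in> M" for u
  proof
    assume u: "u \<in> ?D"
    have "of_int \<lfloor>b \<bullet> u\<rfloor> = b \<bullet> u" if "b \<in> B" for b
      using u B(1) that by (blast intro: of_int_floor)
    then have "g u = (\<Sum>b\<in>B. of_int \<lfloor>b \<bullet> u\<rfloor> *\<^sub>R b)"
      unfolding g_def by (intro sum.cong refl arg_cong2[where f = scaleR]) (rule sym)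
    then show "g u \<in> M" unfolding M_def by (auto intro!: exI[of _ "\<lambda>b. \<lfloor>b \<bullet> u\<rfloor>"])
  next
    assume "g u \<in> M"
    then obtain c :: "'a \<Rightarrow> int" where "g u = (\<Sum>b\<in>B. of_int (c b) *\<^sub>R b)"
      by (auto simp: M_def)
    then have bu: "\<forall>b\<in>B. b \<bullet> u \<in> \<int>" using coords[of u "\<lambda>b. of_int (c b)"] by simp
    have "x \<bullet> u \<in> \<int>" if "x \<in> X" for x
    proof -
      obtain d :: "'a \<Rightarrow> int" where d: "x = (\<Sum>b\<in>B. of_int (d b) *\<^sub>R b)"
        using U B(1,2) card \<open>x \<in> X\<close> unfolding unimodular_def by blast
      have "x \<bullet> u = (\<Sum>b\<in>B. of_int (d b) * (b \<bullet> u))"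
        by (subst d) (simp add: inner_sum_left)
      then show ?thesis using bu by (auto intro!: Ints_sum Ints_mult)
    qed
    then show "u \<in> ?D" by simp
  qed
  ultimately have "?D = inv g ` M"
    by (auto simp: image_iff injg surj_f_inv_f) (metis injg inv_f_f)+
  moreover have "linear (inv g)" "inj (inv g)"
    using linear_injective_imp_surjective[OF lin injg] lin injg
    by (auto simp: surj_imp_inj_inv intro: linear_injective_left_inverse inj_linear_imp_inv_linear)
  ultimately show ?thesis
    using full_rank_lattice_linear_image[OF \<open>full_rank_lattice M\<close>] by metis
qed

section \<open>Zonotopes\<close>

lemma matrix_vector_mult_inner:
  fixes Z :: "real ^ 'r ^ 'n"
  shows "(Z *v y) \<bullet> u = (\<Sum>i\<in>UNIV. y $ i * (column i Z \<bullet> u))"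
  by (simp add: matrix_mult_sum inner_sum_left scalar_mult_eq_scaleR)

text \<open>
  The zonotope is compact and convex, hence determined by its support function. The maximum of a
  linear functional over it is attained by giving each column the coefficient \<open>1\<close> or \<open>-1\<close> according to
  the sign of the functional on that column.
\<close>

lemma mem_zonotope_iff:
  fixes Z :: "real ^ 'r ^ 'n"
  shows "x \<in> zonotope Z \<longleftrightarrow> (\<forall>u. x \<bullet> u \<le> (\<Sum>i\<in>UNIV. \<bar>column i Z \<bullet> u\<bar>))"
proof
  assume "x \<in> zonotope Z"
  then obtain y where y: "x = Z *v y" "\<forall>i. - 1 \<le> y $ i \<and> y $ i \<le> 1"
    by (auto simp: zonotope_def)
  have "y $ i * a \<le> \<bar>a\<bar>" for i and a :: real
  proof -
    have "\<bar>y $ i\<bar> * \<bar>a\<bar> \<le> 1 * \<bar>a\<bar>"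
      using y(2) by (intro mult_right_mono) (auto simp: abs_le_iff minus_le_iff)
    then show ?thesis by (simp add: abs_mult[symmetric])
  qed
  then show "\<forall>u. x \<bullet> u \<le> (\<Sum>i\<in>UNIV. \<bar>column i Z \<bullet> u\<bar>)"
    by (auto simp: y(1) matrix_vector_mult_inner intro: sum_mono)
next
  assume le: "\<forall>u. x \<bullet> u \<le> (\<Sum>i\<in>UNIV. \<bar>column i Z \<bullet> u\<bar>)"
  have eq: "zonotope Z = (*v) Z ` cbox (- 1) 1"
    by (auto simp: zonotope_def mem_box_cart)
  have "compact (zonotope Z)" unfolding eq
    by (intro compact_continuous_image linear_continuous_on matrix_vector_mul_bounded_linear compact_cbox)
  moreover have "convex (zonotope Z)" unfolding eq
    by (intro convex_linear_image matrix_vector_mul_linear convex_box)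
  ultimately show "x \<in> zonotope Z"
  proof (rule_tac ccontr)
    assume "compact (zonotope Z)" "convex (zonotope Z)" "x \<notin> zonotope Z"
    then obtain u b where ub: "u \<bullet> x < b" "\<forall>p\<in>zonotope Z. b < u \<bullet> p"
      using separating_hyperplane_closed_point[of "zonotope Z" x] compact_imp_closed by blast
    \<comment> \<open>Separation puts the zonotope on the side where \<open>u\<close> is large, so \<open>y\<close> minimises \<open>u\<close>.\<close>
    define y :: "real ^ 'r" where "y = (\<chi> i. - sgn (column i Z \<bullet> u))"
    have "Z *v y \<in> zonotope Z" by (auto simp: zonotope_def y_def sgn_if)
    then have "b < (Z *v y) \<bullet> u" using ub(2) inner_commute[of u] by simp
    also have "\<dots> = - (\<Sum>i\<in>UNIV. \<bar>column i Z \<bullet> u\<bar>)"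
      by (simp add: matrix_vector_mult_inner y_def sum_negf[symmetric] sgn_mult_self_eq abs_sgn mult.commute)
    finally have "x \<bullet> (- u) > (\<Sum>i\<in>UNIV. \<bar>column i Z \<bullet> u\<bar>)"
      using ub(1) by (simp add: inner_commute)
    moreover have "x \<bullet> (- u) \<le> (\<Sum>i\<in>UNIV. \<bar>column i Z \<bullet> (- u)\<bar>)" using le by blast
    ultimately show False by simp
  qed
qed

text \<open>
  On vectors with integer products the quadratic bound is weaker than the support function, since
  \<open>\<bar>k\<bar> \<le> k\<^sup>2\<close> for integers \<open>k\<close>. Conversely the two bounds agree on sign vectors, and the support function
  is positively homogeneous and additive along sums without cancellation, so the
  inequality spreads from sign vectors to all vectors.
\<close>

lemma mem_zonotope_iff_dual_lattice:
  fixes Z :: "real ^ 'r ^ 'n" and \<beta> :: "'r \<Rightarrow> real"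
  assumes pos: "\<And>i. \<beta> i > 0" and U: "unimodular {\<beta> i *\<^sub>R column i Z | i. True}"
  shows "x \<in> zonotope Z \<longleftrightarrow>
    (\<forall>u. (\<forall>w\<in>{\<beta> i *\<^sub>R column i Z | i. True}. w \<bullet> u \<in> \<int>) \<longrightarrow>
      x \<bullet> u \<le> (\<Sum>i\<in>UNIV. \<beta> i * (column i Z \<bullet> u)\<^sup>2))"
    (is "_ \<longleftrightarrow> (\<forall>u. ?D u \<longrightarrow> _ u)")
proof
  assume x: "x \<in> zonotope Z"
  show "\<forall>u. ?D u \<longrightarrow> x \<bullet> u \<le> (\<Sum>i\<in>UNIV. \<beta> i * (column i Z \<bullet> u)\<^sup>2)"
  proof (intro allI impI)
    fix u assume D: "?D u"
    have "\<bar>column i Z \<bullet> u\<bar> \<le> \<beta> i * (column i Z \<bullet> u)\<^sup>2" for i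
    proof (cases "column i Z \<bullet> u = 0")
      case False
      have "(\<beta> i *\<^sub>R column i Z) \<bullet> u \<in> \<int>" using D by blast
      moreover have "(\<beta> i *\<^sub>R column i Z) \<bullet> u \<noteq> 0" using False pos[of i] by simp
      ultimately have "1 \<le> \<bar>(\<beta> i *\<^sub>R column i Z) \<bullet> u\<bar>" by (rule Ints_nonzero_abs_ge1)
      then have "1 \<le> \<beta> i * \<bar>column i Z \<bullet> u\<bar>" using pos[of i] by (simp add: abs_mult)
      then have "\<bar>column i Z \<bullet> u\<bar> * 1 \<le> \<bar>column i Z \<bullet> u\<bar> * (\<beta> i * \<bar>column i Z \<bullet> u\<bar>)"
        by (rule mult_left_mono) simp
      also have "\<dots> = \<beta> i * (\<bar>column i Z \<bullet> u\<bar> * \<bar>column i Z \<bullet> u\<bar>)" by (simp only: ac_simps)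
      finally show ?thesis by (simp add: power2_eq_square)
    qed simp
    then have "(\<Sum>i\<in>UNIV. \<bar>column i Z \<bullet> u\<bar>) \<le> (\<Sum>i\<in>UNIV. \<beta> i * (column i Z \<bullet> u)\<^sup>2)"
      by (intro sum_mono)
    then show "x \<bullet> u \<le> (\<Sum>i\<in>UNIV. \<beta> i * (column i Z \<bullet> u)\<^sup>2)"
      using x mem_zonotope_iff[of x Z] by (meson order_trans)
  qed
next
  let ?X = "{\<beta> i *\<^sub>R column i Z | i. True}"
  assume V: "\<forall>u. ?D u \<longrightarrow> x \<bullet> u \<le> (\<Sum>i\<in>UNIV. \<beta> i * (column i Z \<bullet> u)\<^sup>2)"
  have fin: "finite ?X" by (simp add: full_SetCompr_eq)
  have "x \<bullet> u \<le> (\<Sum>i\<in>UNIV. \<bar>column i Z \<bullet> u\<bar>)" for u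
  proof (induction u rule: unimodular_conformal_induct[OF U fin, case_names zero sign add])
    case zero
    then show ?case by simp
  next
    case (sign v s)
    have sq: "\<beta> i * (column i Z \<bullet> v)\<^sup>2 = \<bar>column i Z \<bullet> v\<bar>" for i
    proof -
      have "(\<beta> i *\<^sub>R column i Z) \<bullet> v \<in> {- 1, 0, 1}" using sign(2) by blast
      then have "\<bar>\<beta> i * (column i Z \<bullet> v)\<bar> = 1 \<or> column i Z \<bullet> v = 0" using pos[of i] by auto
      then have "\<beta> i * \<bar>column i Z \<bullet> v\<bar> = 1 \<or> column i Z \<bullet> v = 0"
        using pos[of i] by (simp add: abs_mult)
      moreover have eq: "\<beta> i * (column i Z \<bullet> v)\<^sup>2 = (\<beta> i * \<bar>column i Z \<bullet> v\<bar>) * \<bar>column i Z \<bullet> v\<bar>"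
        by (simp add: power2_eq_square)
      ultimately show ?thesis unfolding eq by (elim disjE) simp_all
    qed
    have "?D v"
    proof
      fix w assume "w \<in> ?X"
      then have "w \<bullet> v \<in> {- 1, 0, 1}" by (rule sign(2))
      then show "w \<bullet> v \<in> \<int>" by auto
    qed
    then have "x \<bullet> v \<le> (\<Sum>i\<in>UNIV. \<beta> i * (column i Z \<bullet> v)\<^sup>2)" using V by blast
    then have "x \<bullet> v \<le> (\<Sum>i\<in>UNIV. \<bar>column i Z \<bullet> v\<bar>)" by (simp add: sq)
    then have "s * (x \<bullet> v) \<le> s * (\<Sum>i\<in>UNIV. \<bar>column i Z \<bullet> v\<bar>)"
      using sign(1) by (intro mult_left_mono) auto
    then show ?case using sign(1) by (simp add: sum_distrib_left abs_mult)
  next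
    case (add v w)
    have "\<bar>column i Z \<bullet> (v + w)\<bar> = \<bar>column i Z \<bullet> v\<bar> + \<bar>column i Z \<bullet> w\<bar>" for i
    proof -
      have "\<bar>(\<beta> i *\<^sub>R column i Z) \<bullet> (v + w)\<bar>
          = \<bar>(\<beta> i *\<^sub>R column i Z) \<bullet> v\<bar> + \<bar>(\<beta> i *\<^sub>R column i Z) \<bullet> w\<bar>"
        by (rule add(3)) blast
      then have "\<beta> i * \<bar>column i Z \<bullet> (v + w)\<bar> = \<beta> i * (\<bar>column i Z \<bullet> v\<bar> + \<bar>column i Z \<bullet> w\<bar>)"
        using pos[of i] by (simp only: inner_scaleR_left abs_mult distrib_left abs_of_pos)
      then show ?thesis using pos[of i] by (metis less_irrefl mult_left_cancel)
    qed
    then show ?case using add(1,2) by (simp add: inner_add_right sum.distrib)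
  qed
  then show "x \<in> zonotope Z" by (simp add: mem_zonotope_iff)
qed

section \<open>The Voronoi cell\<close>

lemma scaled_matrix_form:
  fixes Z :: "real ^ 'r ^ 'n"
  assumes "\<And>i. \<beta> i > 0"
  shows "((scaled_matrix Z \<beta> ** transpose (scaled_matrix Z \<beta>)) *v u) \<bullet> u
    = 2 * (\<Sum>i\<in>UNIV. \<beta> i * (column i Z \<bullet> u)\<^sup>2)"
proof -
  let ?S = "scaled_matrix Z \<beta>"
  have col: "column i ?S = sqrt (2 * \<beta> i) *\<^sub>R column i Z" for i
    by (simp add: scaled_matrix_def column_def vec_eq_iff)
  have tr: "(transpose ?S *v u) $ i = column i ?S \<bullet> u" for i
    by (simp add: matrix_vector_mult_def transpose_def column_def inner_vec_def)
  have "((?S ** transpose ?S) *v u) \<bullet> u = (?S *v (transpose ?S *v u)) \<bullet> u"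
    by (simp only: matrix_vector_mul_assoc)
  also have "\<dots> = (\<Sum>i\<in>UNIV. (column i ?S \<bullet> u) * (column i ?S \<bullet> u))"
    by (simp only: matrix_vector_mult_inner tr)
  also have "\<dots> = (\<Sum>i\<in>UNIV. 2 * (\<beta> i * (column i Z \<bullet> u)\<^sup>2))"
  proof (rule sum.cong)
    fix i
    have "(sqrt (2 * \<beta> i))\<^sup>2 = 2 * \<beta> i" using assms[of i] by simp
    then show "(column i ?S \<bullet> u) * (column i ?S \<bullet> u) = 2 * (\<beta> i * (column i Z \<bullet> u)\<^sup>2)"
      by (simp add: col power2_eq_square algebra_simps)
  qed simp
  finally show ?thesis by (simp add: sum_distrib_left)
qed

theorem theorem2:
  fixes Z :: "real ^ 'r ^ 'n" and \<beta> :: "'r \<Rightarrow> real" and A :: "real ^ 'n ^ 'n"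
  assumes "parallelotope (zonotope Z)"
    and "\<And>i. \<beta> i > 0"
    and "unimodular {\<beta> i *\<^sub>R column i Z | i. True}"
    and "transpose A ** A = matrix_inv (scaled_matrix Z \<beta> ** transpose (scaled_matrix Z \<beta>))"
  shows "voronoi_polytope ((\<lambda>x. A *v x) ` zonotope Z)"
proof -
  let ?X = "{\<beta> i *\<^sub>R column i Z | i. True}"
  define Q where "Q = scaled_matrix Z \<beta> ** transpose (scaled_matrix Z \<beta>)"
  have form: "(Q *v u) \<bullet> u = 2 * (\<Sum>i\<in>UNIV. \<beta> i * (column i Z \<bullet> u)\<^sup>2)" for u
    unfolding Q_def by (rule scaled_matrix_form[OF assms(2)])
  have sp: "span ?X = UNIV" using assms(3) by (simp add: unimodular_def)
  have Q0: "u = 0" if "Q *v u = 0" for u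
  proof (rule ccontr)
    assume "u \<noteq> 0"
    then obtain i where "(\<beta> i *\<^sub>R column i Z) \<bullet> u \<noteq> 0"
      using inner_support_nonempty[OF sp] by blast
    then have "0 < (\<Sum>i\<in>UNIV. \<beta> i * (column i Z \<bullet> u)\<^sup>2)"
      using assms(2) by (intro sum_pos2[of _ i]) (auto simp: less_imp_le)
    then show False using form[of u] that by simp
  qed
  then have invQ: "invertible Q"
    by (simp add: invertible_left_inverse matrix_left_invertible_ker)
  have "Q ** matrix_inv Q = mat 1 \<and> matrix_inv Q ** Q = mat 1"
    using someI_ex[OF invQ[unfolded invertible_def]] unfolding matrix_inv_def .
  then have AAQ: "transpose A ** A ** Q = mat 1"
    using assms(4) unfolding Q_def by simp
  then have "transpose A ** (A ** Q) = mat 1" by (simp add: matrix_mul_assoc)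
  then have invAQ: "invertible (A ** Q)" using invertible_left_inverse by blast
  have invA: "invertible A"
  proof -
    have "Q ** (transpose A ** A) = mat 1" using AAQ matrix_left_right_inverse by blast
    then have "(Q ** transpose A) ** A = mat 1" by (simp only: matrix_mul_assoc)
    then show ?thesis using invertible_left_inverse by blast
  qed
  have dot: "(A *v x) \<bullet> ((A ** Q) *v u) = x \<bullet> u" for x u
  proof -
    have "(A *v x) \<bullet> ((A ** Q) *v u) = x \<bullet> (transpose A *v ((A ** Q) *v u))"
      by (subst (1 2) inner_commute)
        (simp only: transpose_matrix_vector dot_lmul_matrix)
    also have "transpose A *v ((A ** Q) *v u) = u"
      using AAQ by (simp add: matrix_vector_mul_assoc matrix_mul_assoc)
    finally show ?thesis .
  qed
  define D where "D = {u. \<forall>w\<in>?X. w \<bullet> u \<in> \<int>}"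
  define L where "L = (*v) (A ** Q) ` D"
  have "full_rank_lattice D" unfolding D_def by (rule dual_lattice_of_unimodular[OF assms(3)])
  then have "full_rank_lattice L" unfolding L_def
    by (intro full_rank_lattice_linear_image matrix_vector_mul_linear inj_matrix_vector_mult invAQ)
  moreover have "0 \<in> L" unfolding L_def D_def by (rule image_eqI[of _ _ 0]) auto
  moreover have "(*v) A ` zonotope Z = voronoi_cell L 0"
  proof -
    have closer: "dist (A *v x) 0 \<le> dist (A *v x) ((A ** Q) *v u)
        \<longleftrightarrow> x \<bullet> u \<le> (\<Sum>i\<in>UNIV. \<beta> i * (column i Z \<bullet> u)\<^sup>2)" for x u
    proof -
      let ?a = "A *v x" and ?b = "(A ** Q) *v u"
      have "?b \<bullet> ?b = (Q *v u) \<bullet> u"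
        using dot[of "Q *v u" u] by (simp add: matrix_vector_mul_assoc)
      moreover have "dist ?a 0 \<le> dist ?a ?b \<longleftrightarrow> 2 * (?a \<bullet> ?b) \<le> ?b \<bullet> ?b"
        by (simp add: dist_norm norm_le inner_diff_left inner_diff_right inner_commute algebra_simps)
      ultimately show ?thesis using form[of u] dot[of x u] by simp
    qed
    have cell: "A *v x \<in> voronoi_cell L 0 \<longleftrightarrow> x \<in> zonotope Z" for x
      unfolding voronoi_cell_def L_def D_def mem_zonotope_iff_dual_lattice[OF assms(2,3)]
      by (simp only: ball_simps mem_Collect_eq closer)
    have "surj ((*v) A)" using invA by (metis invertible_right_inverse matrix_right_invertible_surjective)
    then have "voronoi_cell L 0 = (*v) A ` {x. A *v x \<in> voronoi_cell L 0}"
      by (rule surj_image_vimage_eq[symmetric, unfolded vimage_def])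
    also have "{x. A *v x \<in> voronoi_cell L 0} = zonotope Z" using cell by blast
    finally show ?thesis by simp
  qed
  ultimately show ?thesis unfolding voronoi_polytope_def by blast
qed

end
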